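(* For $\pi\in\mathcal{S}_n$, let $\widetilde{\mathrm{ASC}}(\pi):=\{n-i: i\in\mathrm{ASC}(\pi)\}$. There exists an involution $\Lambda$ on $\mathcal{S}_n(312)$ that transforms the triple $(\mathrm{DES},\mathsf{pk}_1,\mathsf{lmin})$ to $(\widetilde{\mathrm{ASC}},\mathsf{pk}_2,\mathsf{rmin})$, i.e. for every $\pi\in\mathcal{S}_n(312)$, $$(\mathrm{DES},\mathsf{pk}_1,\mathsf{lmin})(\pi)=(\widetilde{\mathrm{ASC}},\mathsf{pk}_2,\mathsf{rmin})(\Lambda(\pi)).$$ In particular, $\Lambda$ provides an involution proof of the following theorem of Kitaev and Zhang: the two $8$-tuples of statistics $$(\mathsf{mnd},\mathsf{mna},\mathsf{des},\mathsf{asc},\mathsf{ldr},\mathsf{rar},\mathsf{lmin},\mathsf{rmin})\quad\text{and}\quad(\mathsf{mna},\mathsf{mnd},\mathsf{asc},\mathsf{des},\mathsf{rar},\mathsf{ldr},\mathsf{rmin},\mathsf{lmin})$$ are equidistributed over $\mathcal{S}_n(312)$ for $n\geq1$.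
   Context: $\mathcal{S}_n$ is the set of permutations $\pi=\pi_1\pi_2\cdots\pi_n$ of $[n]=\{1,\ldots,n\}$. $\mathcal{S}_n(312)$ is the set of $312$-avoiding permutations in $\mathcal{S}_n$, i.e. those $\pi\in\mathcal{S}_n$ for which there are no indices $1\le i<j<k\le n$ with $\pi_i>\pi_k>\pi_j$. An ascent (resp. descent) of $\pi\in\mathcal{S}_n$ is an index $i\in[n-1]$ with $\pi_i<\pi_{i+1}$ (resp. $\pi_i>\pi_{i+1}$). $\mathrm{ASC}(\pi)$ and $\mathrm{DES}(\pi)$ are the sets of ascents and of descents of $\pi$; $\mathsf{asc}(\pi)=|\mathrm{ASC}(\pi)|$ and $\mathsf{des}(\pi)=|\mathrm{DES}(\pi)|$. With the convention $\pi_0=\pi_{n+1}=0$, a letter $\pi_i$ ($1\le i\le n$) is a peak of $\pi$ if $\pi_{i-1}<\pi_i>\pi_{i+1}$; a peak $\pi_i$ is of type 1 if $\pi_{i-1}\le\pi_{i+1}$ and of type 2 otherwise. $\mathsf{pk}_1(\pi)$ and $\mathsf{pk}_2(\pi)$ are the numbers of type 1 peaks and type 2 peaks of $\pi$. $\mathsf{lmin}(\pi)$ (resp. $\mathsf{rmin}(\pi)$) is the number of left-to-right (resp. right-to-left) minima of $\pi$, i.e. letters smaller than all letters to their left (resp. right). $\mathsf{ldr}(\pi)$ (resp. $\mathsf{rar}(\pi)$) is the largest $j\in[n]$ such that $\pi_1\pi_2\cdots\pi_j$ is decreasing (resp. $\pi_{n-j+1}\pi_{n-j+2}\cdots\pi_n$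 is increasing). Two indices $i<j$ are overlapping if $j=i+1$; $\mathsf{mna}(\pi)$ (resp. $\mathsf{mnd}(\pi)$) is the maximum number of non-overlapping ascents (resp. descents) in $\pi$. Two tuples of statistics are equidistributed over a finite set if they have the same joint distribution on it.
   Formalization: The triple identity is stated for n ≥ 2 only: for n = 1 the single permutation 1 has a type 1 peak (both neighbours are 0), so pk_1 = 1 but pk_2 = 0, and the identity fails; the involution, the 8-tuple exchange and the equidistribution are stated for all n ≥ 1. *)

theory Defs
  imports "HOL-Combinatorics.Multiset_Permutations"
begin

text \<open>A permutation of \<open>{1..n}\<close> is its one-line word, an element of
  \<^term>\<open>permutations_of_set {1..n}\<close>.  Positions are counted from 1; \<open>letter\<close> builds in the
  convention that the letters at positions \<open>0\<close> and \<open>n + 1\<close> are \<open>0\<close>.\<close>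

definition letter :: "nat list \<Rightarrow> nat \<Rightarrow> nat" where
  "letter p i = (if 1 \<le> i \<and> i \<le> length p then p ! (i - 1) else 0)"

definition avoids_312 :: "nat list \<Rightarrow> bool" where
  "avoids_312 p \<longleftrightarrow>
     \<not> (\<exists>i j k. 1 \<le> i \<and> i < j \<and> j < k \<and> k \<le> length p \<and>
          letter p i > letter p k \<and> letter p k > letter p j)"

definition Av_312 :: "nat \<Rightarrow> nat list set" where
  "Av_312 n = {p \<in> permutations_of_set {1..n}. avoids_312 p}"

definition ASC :: "nat list \<Rightarrow> nat set" where
  "ASC p = {i \<in> {1..<length p}. letter p i < letter p (i + 1)}"

definition DES :: "nat list \<Rightarrow> nat set" where
  "DES p = {i \<in> {1..<length p}. letter p i > letter p (i + 1)}"

definition ASC_rev :: "nat list \<Rightarrow> nat set" where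
  "ASC_rev p = {length p - i | i. i \<in> ASC p}"

definition asc :: "nat list \<Rightarrow> nat" where
  "asc p = card (ASC p)"

definition des :: "nat list \<Rightarrow> nat" where
  "des p = card (DES p)"

definition is_peak :: "nat list \<Rightarrow> nat \<Rightarrow> bool" where
  "is_peak p i \<longleftrightarrow> i \<in> {1..length p} \<and>
     letter p (i - 1) < letter p i \<and> letter p i > letter p (i + 1)"

text \<open>Peaks are counted by position.  The two neighbours of a peak are equal only for the
  one-letter word, whose peak is then of type 1; hence an exchange of \<open>pk1\<close> and \<open>pk2\<close> can only be
  expected for words of length at least 2.\<close>

definition pk1 :: "nat list \<Rightarrow> nat" where
  "pk1 p = card {i. is_peak p i \<and> letter p (i - 1) \<le> letter p (i + 1)}"

definition pk2 :: "nat list \<Rightarrow> nat" where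
  "pk2 p = card {i. is_peak p i \<and> \<not> letter p (i - 1) \<le> letter p (i + 1)}"

definition lmin :: "nat list \<Rightarrow> nat" where
  "lmin p = card {i \<in> {1..length p}. \<forall>j\<in>{1..<i}. letter p i < letter p j}"

definition rmin :: "nat list \<Rightarrow> nat" where
  "rmin p = card {i \<in> {1..length p}. \<forall>j\<in>{i<..length p}. letter p i < letter p j}"

text \<open>The next two are meant for nonempty words only.\<close>

definition ldr :: "nat list \<Rightarrow> nat" where
  "ldr p = Max {j \<in> {1..length p}. sorted_wrt (>) (take j p)}"

definition rar :: "nat list \<Rightarrow> nat" where
  "rar p = Max {j \<in> {1..length p}. sorted_wrt (<) (drop (length p - j) p)}"

definition non_overlapping :: "nat set \<Rightarrow> bool" where
  "non_overlapping A \<longleftrightarrow> (\<forall>i\<in>A. \<forall>j\<in>A. j \<noteq> i + 1)"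

definition mna :: "nat list \<Rightarrow> nat" where
  "mna p = Max {card A | A. A \<subseteq> ASC p \<and> non_overlapping A}"

definition mnd :: "nat list \<Rightarrow> nat" where
  "mnd p = Max {card A | A. A \<subseteq> DES p \<and> non_overlapping A}"

definition involution_on :: "'a set \<Rightarrow> ('a \<Rightarrow> 'a) \<Rightarrow> bool" where
  "involution_on A f \<longleftrightarrow> (\<forall>x\<in>A. f x \<in> A \<and> f (f x) = x)"

text \<open>Equality of joint distributions; intended for finite \<open>A\<close>.\<close>

definition equidistributed_on :: "'a set \<Rightarrow> ('a \<Rightarrow> 'b) \<Rightarrow> ('a \<Rightarrow> 'b) \<Rightarrow> bool" where
  "equidistributed_on A f g \<longleftrightarrow> (\<forall>v. card {x \<in> A. f x = v} = card {x \<in> A. g x = v})"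

end

theory Submission
  imports Defs "HOL-Library.Tree"
begin

text \<open>
  Splitting a \<open>312\<close>-avoiding permutation at its letter 1 gives \<open>L 1 R\<close>, where a letter of \<open>L\<close>
  exceeding a letter of \<open>R\<close> would form a \<open>312\<close> pattern together with the 1.  So every letter of \<open>L\<close>
  is smaller than every letter of \<open>R\<close>, and the permutation is determined by the standardizations of
  \<open>L\<close> and \<open>R\<close>, which are again arbitrary \<open>312\<close>-avoiding permutations.  Iterating, the
  permutations in question are the binary trees with \<open>n\<close> nodes: number the nodes in preorder and read
  the numbers in inorder (\<open>bij_betw_word\<close>).  The involution \<open>\<Lambda>\<close> exchanges left and right in the tree.

  Why this exchanges the statistics: in such a tree, node \<open>i\<close> is an ancestor of node \<open>j\<close> (inorder
  positions) exactly if the letter at \<open>i\<close> is the smallest one on the stretch between \<open>i\<close> and \<open>j\<close>.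
  Mirroring reverses inorder positions and keeps ancestry (\<open>stretch_min_mirror\<close>).  Every statistic
  in question only asks about ancestry.  Two adjacent positions carry nodes one of which is an ancestor
  of the other, so ascents and descents swap under reversal.  A left-to-right minimum is an ancestor of
  the first node, a right-to-left minimum an ancestor of the last.  A peak is a leaf, its neighbours
  are ancestors of it, and hence its type records which of the two is an ancestor of the other,
  the boundary zeros acting as common ancestors of everything.

  Finally \<open>mnd\<close>, \<open>des\<close> and \<open>ldr\<close> are functions of the descent set alone, and \<open>mna\<close>, \<open>asc\<close> and
  \<open>rar\<close> are the same functions of the reversed ascent set.  The other four coordinates of the
  8-tuple follow because \<open>\<Lambda>\<close> is an involution, and equidistribution because it is a bijection.
\<close>

section \<open>Binary trees and \<open>312\<close>-avoiding permutations\<close>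

text \<open>The inorder reading of the tree whose nodes are numbered in preorder from \<open>a + 1\<close>.  The offset
  \<open>a\<close> makes the words of subtrees literal factors of the whole word.\<close>

fun word :: "nat \<Rightarrow> unit tree \<Rightarrow> nat list" where
  "word a Leaf = []"
| "word a (Node l u r) = word (a + 1) l @ (a + 1) # word (a + 1 + size l) r"

lemma length_word [simp]: "length (word a t) = size t"
  by (induction a t rule: word.induct) auto

lemma set_word: "set (word a t) = {a<..a + size t}"
  by (induction a t rule: word.induct) auto

lemma distinct_word: "distinct (word a t)"
  by (induction a t rule: word.induct) (auto simp: set_word)

lemma letter_append:
  "letter (xs @ ys) i = (if i \<le> length xs then letter xs i else letter ys (i - length xs))"
proof (cases "i \<le> length xs")
  case False
  then have "i - 1 - length xs = i - length xs - 1" by simp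
  with False show ?thesis by (auto simp: letter_def nth_append)
qed (auto simp: letter_def nth_append)

lemma letter_Cons: "letter (x # xs) i = (if i = 0 then 0 else if i = 1 then x else letter xs (i - 1))"
  by (auto simp: letter_def nth_Cons')

lemma letter_in_set: "1 \<le> i \<Longrightarrow> i \<le> length p \<Longrightarrow> letter p i \<in> set p"
  by (auto simp: letter_def)

lemma in_set_letter: "x \<in> set p \<Longrightarrow> \<exists>i. 1 \<le> i \<and> i \<le> length p \<and> letter p i = x"
proof -
  assume "x \<in> set p"
  then obtain k where "k < length p" "p ! k = x" by (auto simp: in_set_conv_nth)
  then show ?thesis by (intro exI[of _ "Suc k"]) (auto simp: letter_def)
qed

lemma letter_eq_iff:
  assumes "distinct p" "1 \<le> i" "i \<le> length p" "1 \<le> j" "j \<le> length p"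
  shows "letter p i = letter p j \<longleftrightarrow> i = j"
  using assms by (auto simp: letter_def nth_eq_iff_index_eq)

lemma avoids_312_append:
  assumes "avoids_312 (xs @ ys)"
  shows "avoids_312 xs" "avoids_312 ys"
proof -
  have *: "\<not> (letter (xs @ ys) i > letter (xs @ ys) k \<and> letter (xs @ ys) k > letter (xs @ ys) j)"
    if "1 \<le> i" "i < j" "j < k" "k \<le> length (xs @ ys)" for i j k
    using assms that unfolding avoids_312_def by blast
  show "avoids_312 xs" unfolding avoids_312_def
  proof (safe)
    fix i j k assume "1 \<le> i" "i < j" "j < k" "k \<le> length xs"
      "letter xs k < letter xs i" "letter xs j < letter xs k"
    then show False using *[of i j k] by (simp add: letter_append)
  qed
  show "avoids_312 ys" unfolding avoids_312_def
  proof (safe)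
    fix i j k assume "1 \<le> i" "i < j" "j < k" "k \<le> length ys"
      "letter ys k < letter ys i" "letter ys j < letter ys k"
    then show False using *[of "length xs + i" "length xs + j" "length xs + k"]
      by (simp add: letter_append)
  qed
qed

text \<open>Otherwise \<open>x m y\<close> would be an occurrence of \<open>312\<close>.\<close>

lemma avoids_312_around_minimum:
  assumes "avoids_312 (xs @ m # ys)" "x \<in> set xs" "y \<in> set ys" "m < y"
  shows "x \<le> y"
proof (rule ccontr)
  assume "\<not> x \<le> y"
  obtain i where i: "1 \<le> i" "i \<le> length xs" "letter xs i = x"
    using in_set_letter assms(2) by blast
  obtain k where k: "1 \<le> k" "k \<le> length ys" "letter ys k = y"
    using in_set_letter assms(3) by blast
  let ?j = "length xs + 1" and ?k = "length xs + 1 + k" and ?p = "xs @ m # ys"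
  have "letter ?p i = x" "letter ?p ?j = m" "letter ?p ?k = y"
    using i k by (auto simp: letter_append letter_Cons)
  moreover have "1 \<le> i" "i < ?j" "?j < ?k" "?k \<le> length ?p" using i k by auto
  ultimately show False
    using assms(1,4) \<open>\<not> x \<le> y\<close> unfolding avoids_312_def by (metis not_le)
qed

text \<open>The outer entries of a \<open>312\<close> pattern cannot lie on different sides of the root, since the right
  subtree has the larger numbers, and neither of them can be the root, which has the smallest.
  So the pattern would lie within one subtree.\<close>

lemma avoids_312_word: "avoids_312 (word a t)"
proof (induction a t rule: word.induct)
  case (1 a)
  then show ?case by (simp add: avoids_312_def)
next
  case (2 a l u r)
  let ?L = "word (a + 1) l" and ?R = "word (a + 1 + size l) r"
  let ?p = "word a (Node l u r)" and ?s = "size l + 1"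
  have L: "letter ?p i = letter ?L i" "a + 1 < letter ?L i" "letter ?L i \<le> a + 1 + size l"
    if "1 \<le> i" "i < ?s" for i
    using that letter_in_set[of i ?L] by (auto simp: letter_append set_word)
  have M: "letter ?p ?s = a + 1" by (simp add: letter_append letter_Cons)
  have R: "letter ?p i = letter ?R (i - ?s)" "a + 1 + size l < letter ?R (i - ?s)"
    if "?s < i" "i \<le> length ?p" for i
    using that letter_in_set[of "i - ?s" ?R] by (auto simp: letter_append letter_Cons set_word)
  show ?case unfolding avoids_312_def
  proof (safe)
    fix i j k
    assume ij: "1 \<le> i" "i < j" "j < k" "k \<le> length ?p"
      and *: "letter ?p k < letter ?p i" "letter ?p j < letter ?p k"
    consider "k < ?s" | "?s < i" | "i = ?s" | "i < ?s" "k = ?s" | "i < ?s" "?s < k" by linarith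
    then show False
    proof cases
      case 1
      then have "k \<le> length ?L" by simp
      moreover have "letter ?L k < letter ?L i" "letter ?L j < letter ?L k"
        using * L(1)[of i] L(1)[of j] L(1)[of k] 1 ij by auto
      ultimately show False using "2.IH"(1) ij unfolding avoids_312_def by blast
    next
      case 2
      then have "1 \<le> i - ?s" "i - ?s < j - ?s" "j - ?s < k - ?s" "k - ?s \<le> length ?R"
        using ij by auto
      moreover have "letter ?R (k - ?s) < letter ?R (i - ?s)" "letter ?R (j - ?s) < letter ?R (k - ?s)"
        using * R(1)[of i] R(1)[of j] R(1)[of k] 2 ij by auto
      ultimately show False using "2.IH"(2) unfolding avoids_312_def by blast
    next
      case 3
      then show False using * M R[of k] ij by simp
    next
      case 4
      then show False using * M L[of j] ij by simp
    next
      case 5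
      then show False using * L[of i] R[of k] ij by simp
    qed
  qed
qed

text \<open>The tree is found by splitting at the minimum, which becomes the root.  The letters to its left
  are smaller than those to its right, so both sides again occupy intervals of values.\<close>

lemma word_surj:
  assumes "distinct p" "set p = {a<..a + length p}" "avoids_312 p"
  shows "\<exists>t. word a t = p"
  using assms
proof (induction "length p" arbitrary: p a rule: less_induct)
  case less
  show ?case
  proof (cases "p = []")
    case True
    then show ?thesis by (auto intro: exI[of _ Leaf])
  next
    case False
    then have "a + 1 \<in> set p" using less.prems(2) by (cases p) auto
    then obtain xs ys where p: "p = xs @ (a + 1) # ys" by (meson split_list)
    have mem: "set xs \<union> set ys = {a + 1<..a + length p}"
    proof -
      have "set xs \<union> set ys = set p - {a + 1}" using less.prems(1) p by auto
      also have "\<dots> = {a<..a + length p} - {a + 1}" by (simp only: less.prems(2)[symmetric])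
      also have "\<dots> = {a + 1<..a + length p}" by auto
      finally show ?thesis .
    qed
    have dist: "distinct xs" "distinct ys" "set xs \<inter> set ys = {}"
      using less.prems(1) p by auto
    have lt: "x < y" if "x \<in> set xs" "y \<in> set ys" for x y
    proof -
      have "a + 1 < y" using mem that(2) by auto
      then have "x \<le> y"
        using avoids_312_around_minimum[of xs "a + 1" ys x y] less.prems(3) p that by auto
      then show ?thesis using that dist(3) by (cases "x = y") auto
    qed
    \<comment> \<open>\<open>set xs\<close> is an initial segment of an interval, so its size determines it.\<close>
    have down: "z \<in> set xs" if "x \<in> set xs" "a + 1 < z" "z \<le> x" for x z
    proof (rule ccontr)
      assume "z \<notin> set xs"
      have "x \<in> {a + 1<..a + length p}" using mem that(1) by blast
      then have "z \<in> set xs \<union> set ys" unfolding mem using that by auto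
      then show False using \<open>z \<notin> set xs\<close> lt[of x z] that by auto
    qed
    have xs: "set xs = {a + 1<..a + 1 + length xs}"
    proof (cases "xs = []")
      case False
      define M where "M = Max (set xs)"
      have M: "M \<in> set xs" "\<And>x. x \<in> set xs \<Longrightarrow> x \<le> M" unfolding M_def using False by auto
      have interval: "set xs = {a + 1<..M}" using M down mem by fastforce
      have "length xs = card (set xs)" using dist(1) distinct_card by metis
      also have "\<dots> = M - (a + 1)" by (simp only: interval card_greaterThanAtMost)
      finally have "length xs = M - (a + 1)" .
      moreover have "a + 1 < M" using M(1) mem by auto
      ultimately have "M = a + 1 + length xs" by simp
      with interval show ?thesis by simp
    qed auto
    have ys: "set ys = {a + 1 + length xs<..a + 1 + length xs + length ys}"
    proof -
      have "set ys = {a + 1<..a + length p} - set xs" using mem dist(3) by blast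
      also have "\<dots> = {a + 1<..a + length p} - {a + 1<..a + 1 + length xs}" by (simp only: xs)
      also have "\<dots> = {a + 1 + length xs<..a + 1 + length xs + length ys}" using p by auto
      finally show ?thesis .
    qed
    have av: "avoids_312 xs" "avoids_312 ys"
      using avoids_312_append[of xs "(a + 1) # ys"] avoids_312_append(2)[of "xs @ [a + 1]" ys]
        less.prems(3) p by auto
    obtain l where l: "word (a + 1) l = xs"
      using less.hyps[of xs "a + 1"] dist(1) xs av(1) p by auto
    obtain r where r: "word (a + 1 + length xs) r = ys"
      using less.hyps[of ys "a + 1 + length xs"] dist(2) ys av(2) p by auto
    have "size l = length xs" using l length_word by metis
    then have "word a (Node l () r) = p" using l r p by simp
    then show ?thesis by blast
  qed
qed

text \<open>The root is recovered as the position of the unique letter \<open>a + 1\<close>.\<close>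

lemma word_inj: "word a s = word a t \<Longrightarrow> s = t"
proof (induction a s arbitrary: t rule: word.induct)
  case (1 a)
  then show ?case by (cases t) auto
next
  case (2 a l u r)
  from 2(3) obtain l' v r' where t: "t = Node l' v r'" by (cases t) auto
  have "a + 1 \<notin> set (word (a + 1) l)" "a + 1 \<notin> set (word (a + 1 + size l) r)"
    by (auto simp: set_word)
  moreover have "word (a + 1) l @ (a + 1) # word (a + 1 + size l) r =
    word (a + 1) l' @ (a + 1) # word (a + 1 + size l') r'" using 2(3) t by simp
  ultimately have eq: "word (a + 1) l = word (a + 1) l'"
      "word (a + 1 + size l) r = word (a + 1 + size l') r'"
    by (metis append_Cons_eq_iff)+
  from eq(1) have "l = l'" using 2(1) by blast
  with eq(2) show ?case using 2(2) t by auto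
qed

lemma bij_betw_word: "bij_betw (word 0) {t. size t = n} (Av_312 n)"
proof (rule bij_betw_imageI)
  show "inj_on (word 0) {t. size t = n}" by (auto intro: inj_onI word_inj)
  have "word 0 t \<in> Av_312 (size t)" for t
    by (auto simp: Av_312_def permutations_of_set_def set_word distinct_word avoids_312_word)
  moreover have "p \<in> word 0 ` {t. size t = n}" if "p \<in> Av_312 n" for p
  proof -
    have p: "distinct p" "set p = {1..n}" "avoids_312 p"
      using that by (auto simp: Av_312_def permutations_of_set_def)
    then have "length p = n" using distinct_card[of p] by simp
    moreover have "{1..n} = {0<..n}" by auto
    ultimately obtain t where "word 0 t = p" using word_surj[of p 0] p by auto
    with \<open>length p = n\<close> show ?thesis using length_word[of 0 t] by auto
  qed
  ultimately show "word 0 ` {t. size t = n} = Av_312 n" by auto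
qed

section \<open>Ancestry as minimality on a stretch\<close>

text \<open>For the word of a tree this says that node \<open>i\<close> is an ancestor of node \<open>j\<close> or equal to it.\<close>

definition stretch_min :: "nat list \<Rightarrow> nat \<Rightarrow> nat \<Rightarrow> bool" where
  "stretch_min p i j \<longleftrightarrow> (\<forall>k\<in>{min i j..max i j}. letter p i \<le> letter p k)"

text \<open>The recursion for ancestry: the root is an ancestor of everything, and a node in a subtree is only
  an ancestor of nodes in that subtree, because any stretch leaving the subtree meets the root.\<close>

lemma stretch_min_Node:
  assumes ij: "1 \<le> i" "i \<le> size (Node l u r)" "1 \<le> j" "j \<le> size (Node l u r)"
  shows "stretch_min (word a (Node l u r)) i j \<longleftrightarrow>
    i = size l + 1 \<or>
    i < size l + 1 \<and> j < size l + 1 \<and> stretch_min (word (a + 1) l) i j \<or>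
    size l + 1 < i \<and> size l + 1 < j \<and>
      stretch_min (word (a + 1 + size l) r) (i - (size l + 1)) (j - (size l + 1))"
proof -
  let ?L = "word (a + 1) l" and ?R = "word (a + 1 + size l) r"
  let ?p = "word a (Node l u r)" and ?s = "size l + 1"
  have root: "letter ?p ?s = a + 1" by (simp add: letter_append letter_Cons)
  have above: "a + 1 < letter ?p k" if "1 \<le> k" "k \<le> size (Node l u r)" "k \<noteq> ?s" for k
  proof -
    have "letter ?p k \<in> set ?p" using that by (intro letter_in_set) auto
    then have "a < letter ?p k" by (simp add: set_word del: word.simps)
    moreover have "letter ?p k \<noteq> letter ?p ?s"
      using that letter_eq_iff[OF distinct_word, of k a "Node l u r" ?s] by (simp del: word.simps)
    ultimately show ?thesis using root by linarith
  qed
  have L: "letter ?p k = letter ?L k" if "k < ?s" for k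
    using that by (simp add: letter_append)
  have R: "letter ?p k = letter ?R (k - ?s)" if "?s < k" for k
    using that by (auto simp: letter_append letter_Cons)
  consider "i = ?s" | "i < ?s" "j < ?s" | "?s < i" "?s < j" | "i < ?s" "?s \<le> j" | "?s < i" "j \<le> ?s"
    by linarith
  then show ?thesis
  proof cases
    case 1
    have "letter ?p i \<le> letter ?p k" if "k \<in> {min i j..max i j}" for k
    proof (cases "k = ?s")
      case False
      have "1 \<le> k" "k \<le> size (Node l u r)" using that ij by (auto simp: min_def max_def split: if_splits)
      then show ?thesis using above[of k] root 1 False by (simp del: word.simps)
    qed (simp add: 1)
    then show ?thesis using 1 unfolding stretch_min_def by blast
  next
    case 2
    then have "letter ?p k = letter ?L k" if "k \<in> {min i j..max i j}" for k
      using that L by auto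
    moreover have "i \<in> {min i j..max i j}" by auto
    ultimately have "stretch_min ?p i j \<longleftrightarrow> stretch_min ?L i j"
      unfolding stretch_min_def by metis
    then show ?thesis using 2 by auto
  next
    case 3
    have "stretch_min ?p i j \<longleftrightarrow> stretch_min ?R (i - ?s) (j - ?s)"
    proof
      assume *: "stretch_min ?p i j"
      show "stretch_min ?R (i - ?s) (j - ?s)" unfolding stretch_min_def
      proof
        fix k assume k: "k \<in> {min (i - ?s) (j - ?s)..max (i - ?s) (j - ?s)}"
        then have "k + ?s \<in> {min i j..max i j}" "?s < k + ?s" using 3 by auto
        then show "letter ?R (i - ?s) \<le> letter ?R k"
          using * R[of i] R[of "k + ?s"] 3 unfolding stretch_min_def by (metis diff_add_inverse2)
      qed
    next
      assume *: "stretch_min ?R (i - ?s) (j - ?s)"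
      show "stretch_min ?p i j" unfolding stretch_min_def
      proof
        fix k assume k: "k \<in> {min i j..max i j}"
        then have "k - ?s \<in> {min (i - ?s) (j - ?s)..max (i - ?s) (j - ?s)}" "?s < k" using 3 by auto
        then show "letter ?p i \<le> letter ?p k"
          using * R[of i] R[of k] 3 unfolding stretch_min_def by metis
      qed
    qed
    then show ?thesis using 3 by auto
  next
    case 4
    then have "?s \<in> {min i j..max i j}" by auto
    then have "\<not> stretch_min ?p i j" using above[of i] root 4 ij unfolding stretch_min_def
      by (metis not_le less_irrefl)
    then show ?thesis using 4 by auto
  next
    case 5
    then have "?s \<in> {min i j..max i j}" by auto
    then have "\<not> stretch_min ?p i j" using above[of i] root 5 ij unfolding stretch_min_def
      by (metis not_le less_irrefl)
    then show ?thesis using 5 by auto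
  qed
qed

text \<open>The recursion above is symmetric under exchanging left and right.\<close>

lemma stretch_min_mirror:
  assumes "1 \<le> i" "i \<le> size t" "1 \<le> j" "j \<le> size t"
  shows "stretch_min (word a t) i j \<longleftrightarrow>
    stretch_min (word b (mirror t)) (size t + 1 - i) (size t + 1 - j)"
  using assms
proof (induction t arbitrary: a b i j)
  case Leaf
  then show ?case by simp
next
  case (Node l u r)
  let ?i = "size (Node l u r) + 1 - i" and ?j = "size (Node l u r) + 1 - j"
  let ?s = "size l + 1" and ?s' = "size r + 1"
  have right: "stretch_min (word (a + 1 + size l) r) (i - ?s) (j - ?s) \<longleftrightarrow>
      stretch_min (word (b + 1) (mirror r)) ?i ?j" if "?s < i" "?s < j"
  proof -
    have "size r + 1 - (i - ?s) = ?i" "size r + 1 - (j - ?s) = ?j" using that Node.prems by auto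
    then show ?thesis
      using Node.IH(2)[of "i - ?s" "j - ?s" "a + 1 + size l" "b + 1"] that Node.prems by auto
  qed
  have left: "stretch_min (word (a + 1) l) i j \<longleftrightarrow>
      stretch_min (word (b + 1 + size (mirror r)) (mirror l)) (?i - ?s') (?j - ?s')"
    if "i < ?s" "j < ?s"
  proof -
    have "size l + 1 - i = ?i - ?s'" "size l + 1 - j = ?j - ?s'" using that Node.prems by auto
    then show ?thesis
      using Node.IH(1)[of i j "a + 1" "b + 1 + size r"] that Node.prems by auto
  qed
  have pos: "i = ?s \<longleftrightarrow> ?i = ?s'" "i < ?s \<longleftrightarrow> ?s' < ?i" "?s < i \<longleftrightarrow> ?i < ?s'"
      "j < ?s \<longleftrightarrow> ?s' < ?j" "?s < j \<longleftrightarrow> ?j < ?s'" using Node.prems by auto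
  have "stretch_min (word b (mirror (Node l u r))) ?i ?j \<longleftrightarrow>
    ?i = ?s' \<or>
    ?i < ?s' \<and> ?j < ?s' \<and> stretch_min (word (b + 1) (mirror r)) ?i ?j \<or>
    ?s' < ?i \<and> ?s' < ?j \<and>
      stretch_min (word (b + 1 + size (mirror r)) (mirror l)) (?i - ?s') (?j - ?s')"
    using stretch_min_Node[of ?i "mirror r" u "mirror l" ?j b] Node.prems by simp
  then show ?case
    using stretch_min_Node[of i l u r j a] Node.prems left right pos by metis
qed

section \<open>Statistics determined by ancestry\<close>

text \<open>All that the comparison of statistics needs to know about a word and the word of the mirrored tree.
  The boundary positions \<open>0\<close> and \<open>n + 1\<close> are included so that peaks at the ends of a word need no
  separate treatment.\<close>

definition reflected :: "nat list \<Rightarrow> nat list \<Rightarrow> bool" where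
  "reflected p q \<longleftrightarrow> length p = length q \<and>
     distinct p \<and> 0 \<notin> set p \<and> distinct q \<and> 0 \<notin> set q \<and>
     (\<forall>i j. i \<le> length p + 1 \<longrightarrow> j \<le> length p + 1 \<longrightarrow>
        (stretch_min p i j \<longleftrightarrow> stretch_min q (length p + 1 - i) (length p + 1 - j)))"

lemma letter_outside: "i = 0 \<or> length p < i \<Longrightarrow> letter p i = 0"
  by (auto simp: letter_def)

lemma letter_pos: "0 \<notin> set p \<Longrightarrow> 1 \<le> i \<Longrightarrow> i \<le> length p \<Longrightarrow> 0 < letter p i"
  using letter_in_set by (metis gr0I)

lemma stretch_min_outside:
  assumes "0 \<notin> set p" "i = 0 \<or> i = length p + 1 \<or> j = 0 \<or> j = length p + 1" 
    "i \<le> length p + 1"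
  shows "stretch_min p i j \<longleftrightarrow> i = 0 \<or> i = length p + 1"
proof (cases "i = 0 \<or> i = length p + 1")
  case True
  then show ?thesis using letter_outside[of i p] by (auto simp: stretch_min_def)
next
  case False
  then have "0 < letter p i" "letter p j = 0"
    using assms letter_pos[of p i] letter_outside[of j p] by auto
  moreover have "j \<in> {min i j..max i j}" by auto
  ultimately show ?thesis using False unfolding stretch_min_def by (metis not_le)
qed

text \<open>At the boundary positions the letter \<open>0\<close> is below all others, on both sides of the reflection.\<close>

lemma reflected_word_mirror: "reflected (word 0 t) (word 0 (mirror t))"
proof -
  let ?p = "word 0 t" and ?q = "word 0 (mirror t)" and ?n = "size t"
  have z: "0 \<notin> set ?p" "0 \<notin> set ?q" by (auto simp: set_word)
  have "stretch_min ?p i j \<longleftrightarrow> stretch_min ?q (?n + 1 - i) (?n + 1 - j)"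
    if "i \<le> ?n + 1" "j \<le> ?n + 1" for i j
  proof (cases "i = 0 \<or> i = ?n + 1 \<or> j = 0 \<or> j = ?n + 1")
    case True
    then show ?thesis
      using stretch_min_outside[OF z(1), of i j]
        stretch_min_outside[OF z(2), of "?n + 1 - i" "?n + 1 - j"] that by auto
  next
    case False
    then show ?thesis using stretch_min_mirror[of i t j 0 0] that by auto
  qed
  then show ?thesis using z by (simp add: reflected_def distinct_word)
qed

lemma stretch_min_adjacent:
  "stretch_min p i (Suc i) \<longleftrightarrow> letter p i \<le> letter p (Suc i)"
  "stretch_min p (Suc i) i \<longleftrightarrow> letter p (Suc i) \<le> letter p i"
proof -
  have "{min i (Suc i)..max i (Suc i)} = {i, Suc i}" "{min (Suc i) i..max (Suc i) i} = {i, Suc i}"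
    by auto
  then show "stretch_min p i (Suc i) \<longleftrightarrow> letter p i \<le> letter p (Suc i)"
    "stretch_min p (Suc i) i \<longleftrightarrow> letter p (Suc i) \<le> letter p i"
    by (auto simp: stretch_min_def)
qed

lemma reflected_adjacent:
  assumes "reflected p q" "i \<le> length p"
  shows "letter p i \<le> letter p (Suc i) \<longleftrightarrow>
           letter q (Suc (length p - i)) \<le> letter q (length p - i)"
    and "letter p (Suc i) \<le> letter p i \<longleftrightarrow>
           letter q (length p - i) \<le> letter q (Suc (length p - i))"
proof -
  have "stretch_min p i (Suc i) = stretch_min q (Suc (length p - i)) (length p - i)"
    "stretch_min p (Suc i) i = stretch_min q (length p - i) (Suc (length p - i))"
    using assms by (auto simp: reflected_def Suc_diff_le)
  then show "letter p i \<le> letter p (Suc i) \<longleftrightarrow>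
           letter q (Suc (length p - i)) \<le> letter q (length p - i)"
    "letter p (Suc i) \<le> letter p i \<longleftrightarrow>
           letter q (length p - i) \<le> letter q (Suc (length p - i))"
    by (simp_all add: stretch_min_adjacent)
qed

lemma reflected_DES: "reflected p q \<Longrightarrow> DES p = ASC_rev q"
proof -
  assume r: "reflected p q"
  let ?n = "length p"
  have n: "length q = ?n" using r by (simp add: reflected_def)
  have iff: "i \<in> DES p \<longleftrightarrow> ?n - i \<in> ASC q" if "1 \<le> i" "i < ?n" for i
    using reflected_adjacent(1)[OF r, of i] that n
    by (auto simp: DES_def ASC_def not_le[symmetric])
  have "i \<in> DES p \<longleftrightarrow> i \<in> ASC_rev q" for i
  proof
    assume i: "i \<in> DES p"
    then have "1 \<le> i" "i < ?n" by (auto simp: DES_def)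
    then show "i \<in> ASC_rev q" using i iff n unfolding ASC_rev_def
      by (intro CollectI exI[of _ "?n - i"]) auto
  next
    assume "i \<in> ASC_rev q"
    then obtain j where j: "i = ?n - j" "j \<in> ASC q" by (auto simp: ASC_rev_def n)
    then have "1 \<le> j" "j < ?n" by (auto simp: ASC_def n)
    then show "i \<in> DES p" using j iff[of i] by auto
  qed
  then show ?thesis by blast
qed

text \<open>Reversal sends peaks to peaks.  The two neighbours of a peak are both smaller than it, so the
  smaller neighbour is the minimum of the stretch of three letters, and reversal swaps the neighbours.\<close>

lemma reflected_pk:
  assumes r: "reflected p q" and "2 \<le> length p"
  shows "pk1 p = pk2 q"
proof -
  let ?n = "length p"
  have n: "length q = ?n" and q: "distinct q" "0 \<notin> set q" using r by (auto simp: reflected_def)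
  have peak: "is_peak p i \<longleftrightarrow> is_peak q (?n + 1 - i)" if "1 \<le> i" "i \<le> ?n" for i
    using reflected_adjacent(1)[OF r, of i] reflected_adjacent(2)[OF r, of "i - 1"] that n
    by (auto simp: is_peak_def not_le[symmetric] Suc_diff_le)
  have type: "letter p (i - 1) \<le> letter p (i + 1) \<longleftrightarrow>
      \<not> letter q (?n + 1 - i - 1) \<le> letter q (?n + 1 - i + 1)" if "is_peak p i" for i
  proof -
    have i: "1 \<le> i" "i \<le> ?n" using that by (auto simp: is_peak_def)
    let ?i = "?n + 1 - i"
    have *: "stretch_min w (k - 1) (k + 1) \<longleftrightarrow> letter w (k - 1) \<le> letter w (k + 1)"
      "stretch_min w (k + 1) (k - 1) \<longleftrightarrow> letter w (k + 1) \<le> letter w (k - 1)"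
      if "is_peak w k" for w k
    proof -
      have "{min (k - 1) (k + 1)..max (k - 1) (k + 1)} = {k - 1, k, k + 1}"
        "{min (k + 1) (k - 1)..max (k + 1) (k - 1)} = {k - 1, k, k + 1}" by auto
      then show "stretch_min w (k - 1) (k + 1) \<longleftrightarrow> letter w (k - 1) \<le> letter w (k + 1)"
        "stretch_min w (k + 1) (k - 1) \<longleftrightarrow> letter w (k + 1) \<le> letter w (k - 1)"
        using that by (auto simp: stretch_min_def is_peak_def)
    qed
    have "?n + 1 - (i - 1) = ?i + 1" "?n + 1 - (i + 1) = ?i - 1" using i by auto
    then have "stretch_min p (i - 1) (i + 1) \<longleftrightarrow> stretch_min q (?i + 1) (?i - 1)"
      using r i unfolding reflected_def by simp
    then have "letter p (i - 1) \<le> letter p (i + 1) \<longleftrightarrow> letter q (?i + 1) \<le> letter q (?i - 1)"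
      using * that peak i by blast
    moreover have "letter q (?i + 1) \<noteq> letter q (?i - 1)"
    proof (cases "i = 1 \<or> i = ?n")
      case True
      \<comment> \<open>Exactly one neighbour lies outside the word and is \<open>0\<close>: this is where length 2 is needed.\<close>
      have "1 \<le> ?n - 1" "2 \<le> ?n" using assms(2) by auto
      then have "0 < letter q (?n - 1)" "0 < letter q 2" using n letter_pos[OF q(2)] by auto
      moreover have "letter q 0 = 0" "letter q (?n + 1) = 0" using n by (auto simp: letter_outside)
      ultimately show ?thesis using True by (auto simp: numeral_2_eq_2)
    next
      case False
      then have "1 \<le> ?i - 1" "?i + 1 \<le> length q" "?i - 1 < ?i + 1" using i n by auto
      then show ?thesis using letter_eq_iff[OF q(1), of "?i + 1" "?i - 1"] by linarith
    qed
    ultimately show ?thesis by auto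
  qed
  have "bij_betw (\<lambda>i. ?n + 1 - i) {i. is_peak p i \<and> letter p (i - 1) \<le> letter p (i + 1)}
      {i. is_peak q i \<and> \<not> letter q (i - 1) \<le> letter q (i + 1)}"
  proof (rule bij_betwI[where g = "\<lambda>i. ?n + 1 - i"])
    show "(\<lambda>i. ?n + 1 - i) \<in> {i. is_peak p i \<and> letter p (i - 1) \<le> letter p (i + 1)} \<rightarrow>
      {i. is_peak q i \<and> \<not> letter q (i - 1) \<le> letter q (i + 1)}"
    proof
      fix i assume i: "i \<in> {i. is_peak p i \<and> letter p (i - 1) \<le> letter p (i + 1)}"
      then have "1 \<le> i" "i \<le> ?n" by (auto simp: is_peak_def)
      then show "?n + 1 - i \<in> {i. is_peak q i \<and> \<not> letter q (i - 1) \<le> letter q (i + 1)}"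
        using i peak type by blast
    qed
    show "(\<lambda>i. ?n + 1 - i) \<in> {i. is_peak q i \<and> \<not> letter q (i - 1) \<le> letter q (i + 1)} \<rightarrow>
      {i. is_peak p i \<and> letter p (i - 1) \<le> letter p (i + 1)}"
    proof
      fix i assume i: "i \<in> {i. is_peak q i \<and> \<not> letter q (i - 1) \<le> letter q (i + 1)}"
      then have "1 \<le> i" "i \<le> ?n" by (auto simp: is_peak_def n)
      then have "1 \<le> ?n + 1 - i" "?n + 1 - i \<le> ?n" "?n + 1 - (?n + 1 - i) = i" by auto
      then show "?n + 1 - i \<in> {i. is_peak p i \<and> letter p (i - 1) \<le> letter p (i + 1)}"
        using i peak[of "?n + 1 - i"] type[of "?n + 1 - i"] by auto
    qed
  qed (auto simp: is_peak_def n)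
  then show ?thesis unfolding pk1_def pk2_def by (rule bij_betw_same_card)
qed

text \<open>Position \<open>i\<close> is a left-to-right minimum iff it is minimal on the stretch to position 1, and a
  right-to-left minimum iff it is minimal on the stretch to position \<open>n\<close>.\<close>

lemma reflected_lmin:
  assumes r: "reflected p q"
  shows "lmin p = rmin q"
proof -
  let ?n = "length p"
  have n: "length q = ?n" and d: "distinct p" "distinct q" using r by (auto simp: reflected_def)
  have L: "(\<forall>j\<in>{1..<i}. letter p i < letter p j) \<longleftrightarrow> stretch_min p i 1"
    if "1 \<le> i" "i \<le> ?n" for i
  proof -
    have "letter p i < letter p j \<longleftrightarrow> letter p i \<le> letter p j" if "j \<in> {1..<i}" for j
      using letter_eq_iff[OF d(1), of i j] that \<open>i \<le> ?n\<close> by auto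
    moreover have "{min i 1..max i 1} = insert i {1..<i}" using that by auto
    ultimately show ?thesis unfolding stretch_min_def by auto
  qed
  have R: "(\<forall>j\<in>{i<..length q}. letter q i < letter q j) \<longleftrightarrow> stretch_min q i ?n"
    if "1 \<le> i" "i \<le> ?n" for i
  proof -
    have "letter q i < letter q j \<longleftrightarrow> letter q i \<le> letter q j" if "j \<in> {i<..?n}" for j
      using letter_eq_iff[OF d(2), of i j] that \<open>1 \<le> i\<close> n by auto
    moreover have "{min i ?n..max i ?n} = insert i {i<..?n}" using that by auto
    ultimately show ?thesis unfolding stretch_min_def n by auto
  qed
  have "stretch_min p i 1 \<longleftrightarrow> stretch_min q (?n + 1 - i) ?n" if "1 \<le> i" "i \<le> ?n" for i
  proof -
    have "stretch_min p i 1 \<longleftrightarrow> stretch_min q (?n + 1 - i) (?n + 1 - 1)"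
      using r that unfolding reflected_def by (simp del: One_nat_def)
    then show ?thesis by simp
  qed
  then have eq: "(\<forall>j\<in>{1..<i}. letter p i < letter p j) \<longleftrightarrow>
      (\<forall>j\<in>{?n + 1 - i<..length q}. letter q (?n + 1 - i) < letter q j)"
    if "1 \<le> i" "i \<le> ?n" for i
    using L[of i] R[of "?n + 1 - i"] that by auto
  have "bij_betw (\<lambda>i. ?n + 1 - i) {i \<in> {1..?n}. \<forall>j\<in>{1..<i}. letter p i < letter p j}
     {i \<in> {1..length q}. \<forall>j\<in>{i<..length q}. letter q i < letter q j}"
  proof (rule bij_betwI[where g = "\<lambda>i. ?n + 1 - i"])
    show "(\<lambda>i. ?n + 1 - i) \<in> {i \<in> {1..?n}. \<forall>j\<in>{1..<i}. letter p i < letter p j} \<rightarrow>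
      {i \<in> {1..length q}. \<forall>j\<in>{i<..length q}. letter q i < letter q j}"
      using eq by (auto simp: n)
    show "(\<lambda>i. ?n + 1 - i) \<in> {i \<in> {1..length q}. \<forall>j\<in>{i<..length q}. letter q i < letter q j} \<rightarrow>
      {i \<in> {1..?n}. \<forall>j\<in>{1..<i}. letter p i < letter p j}"
    proof
      fix i assume i: "i \<in> {i \<in> {1..length q}. \<forall>j\<in>{i<..length q}. letter q i < letter q j}"
      then have "1 \<le> ?n + 1 - i" "?n + 1 - i \<le> ?n" "?n + 1 - (?n + 1 - i) = i"
        by (auto simp: n)
      then show "?n + 1 - i \<in> {i \<in> {1..?n}. \<forall>j\<in>{1..<i}. letter p i < letter p j}"
        using i eq[of "?n + 1 - i"] by auto
    qed
  qed (auto simp: n)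
  then show ?thesis unfolding lmin_def rmin_def by (rule bij_betw_same_card)
qed

section \<open>Statistics determined by the descent set\<close>

lemma ASC_rev_image: "ASC_rev p = (\<lambda>i. length p - i) ` ASC p"
  by (auto simp: ASC_rev_def)

lemma inj_on_reverse_ASC: "inj_on (\<lambda>i. length p - i) (ASC p)"
  by (auto simp: inj_on_def ASC_def)

lemma des_eq_asc: "DES p = ASC_rev q \<Longrightarrow> des p = asc q"
  by (simp add: des_def asc_def ASC_rev_image card_image inj_on_reverse_ASC)

text \<open>Reversal of positions preserves adjacency, hence non-overlapping sets and their sizes.\<close>

lemma mnd_eq_mna:
  assumes "DES p = ASC_rev q"
  shows "mnd p = mna q"
proof -
  let ?n = "length q" and ?f = "\<lambda>i. length q - i"
  have A: "ASC q \<subseteq> {1..<?n}" by (auto simp: ASC_def)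
  have inv: "?f ` ?f ` B = B" if "B \<subseteq> {1..<?n}" for B
  proof -
    have "?f (?f i) = i" if "i \<in> B" for i using that \<open>B \<subseteq> {1..<?n}\<close> by auto
    then show ?thesis by (simp add: image_image)
  qed
  have non: "non_overlapping (?f ` B)" if "B \<subseteq> {1..<?n}" "non_overlapping B" for B
    unfolding non_overlapping_def
  proof (intro ballI)
    fix i j assume "i \<in> ?f ` B" "j \<in> ?f ` B"
    then obtain i' j' where *: "i = ?n - i'" "j = ?n - j'" "i' \<in> B" "j' \<in> B" by auto
    then have "i' \<noteq> j' + 1" "i' < ?n" "j' < ?n"
      using that unfolding non_overlapping_def by (metis, auto)
    then show "j \<noteq> i + 1" using * by auto
  qed
  have card: "card (?f ` B) = card B" if "B \<subseteq> {1..<?n}" for B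
  proof (rule card_image, rule inj_onI)
    fix x y assume "x \<in> B" "y \<in> B" "?f x = ?f y"
    moreover from this that have "x < ?n" "y < ?n" by auto
    ultimately show "x = y" by simp
  qed
  have "{card B | B. B \<subseteq> DES p \<and> non_overlapping B} = {card B | B. B \<subseteq> ASC q \<and> non_overlapping B}"
    (is "?D = ?A")
  proof (intro subset_antisym subsetI)
    fix x assume "x \<in> ?D"
    then obtain B where B: "x = card B" "B \<subseteq> ?f ` ASC q" "non_overlapping B"
      using assms by (auto simp: ASC_rev_image)
    moreover have "?f ` ASC q \<subseteq> {1..<?n}" using A by force
    then have "B \<subseteq> {1..<?n}" using B(2) by (rule order_trans[rotated])
    moreover have "?f ` B \<subseteq> ASC q" using B(2) inv[OF A] by (metis image_mono)
    ultimately show "x \<in> ?A" using non card by (intro CollectI exI[of _ "?f ` B"]) auto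
  next
    fix x assume "x \<in> ?A"
    then obtain B where B: "x = card B" "B \<subseteq> ASC q" "non_overlapping B" by auto
    moreover have "B \<subseteq> {1..<?n}" using B(2) A by auto
    moreover have "?f ` B \<subseteq> DES p" using B(2) assms by (auto simp: ASC_rev_image)
    ultimately show "x \<in> ?D" using non card by (intro CollectI exI[of _ "?f ` B"]) auto
  qed
  then show ?thesis by (simp add: mnd_def mna_def)
qed

lemma decreasing_take_iff:
  assumes "j \<le> length p"
  shows "sorted_wrt (>) (take j p) \<longleftrightarrow> {1..<j} \<subseteq> DES p"
proof -
  have "sorted_wrt (>) (take j p) \<longleftrightarrow> (\<forall>i. Suc i < j \<longrightarrow> p ! i > p ! Suc i)"
    using assms by (subst sorted_wrt_iff_nth_Suc_transp) (auto simp: transp_def)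
  also have "\<dots> \<longleftrightarrow> {1..<j} \<subseteq> DES p"
  proof
    assume *: "\<forall>i. Suc i < j \<longrightarrow> p ! i > p ! Suc i"
    show "{1..<j} \<subseteq> DES p"
    proof
      fix i assume "i \<in> {1..<j}"
      then show "i \<in> DES p" using *[rule_format, of "i - 1"] assms by (auto simp: DES_def letter_def)
    qed
  next
    assume *: "{1..<j} \<subseteq> DES p"
    show "\<forall>i. Suc i < j \<longrightarrow> p ! i > p ! Suc i"
    proof (intro allI impI)
      fix i assume "Suc i < j"
      then have "Suc i \<in> DES p" using * by auto
      then show "p ! i > p ! Suc i" using \<open>Suc i < j\<close> assms by (auto simp: DES_def letter_def)
    qed
  qed
  finally show ?thesis .
qed

lemma increasing_drop_iff:
  assumes "j \<le> length p"
  shows "sorted_wrt (<) (drop (length p - j) p) \<longleftrightarrow> {length p - j<..<length p} \<subseteq> ASC p"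
proof -
  let ?n = "length p"
  have "sorted_wrt (<) (drop (?n - j) p) \<longleftrightarrow>
      (\<forall>i. Suc i < j \<longrightarrow> p ! (?n - j + i) < p ! (?n - j + Suc i))"
    using assms by (subst sorted_wrt_iff_nth_Suc_transp) (auto simp: transp_def)
  also have "\<dots> \<longleftrightarrow> {?n - j<..<?n} \<subseteq> ASC p"
  proof
    assume *: "\<forall>i. Suc i < j \<longrightarrow> p ! (?n - j + i) < p ! (?n - j + Suc i)"
    show "{?n - j<..<?n} \<subseteq> ASC p"
    proof
      fix i assume i: "i \<in> {?n - j<..<?n}"
      then have "?n - j + (i - 1 - (?n - j)) = i - 1" "?n - j + Suc (i - 1 - (?n - j)) = i"
        "Suc (i - 1 - (?n - j)) < j" using assms by auto
      then have "p ! (i - 1) < p ! i" using *[rule_format, of "i - 1 - (?n - j)"] by simp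
      then show "i \<in> ASC p" using i by (auto simp: ASC_def letter_def)
    qed
  next
    assume *: "{?n - j<..<?n} \<subseteq> ASC p"
    show "\<forall>i. Suc i < j \<longrightarrow> p ! (?n - j + i) < p ! (?n - j + Suc i)"
    proof (intro allI impI)
      fix i assume i: "Suc i < j"
      then have "?n - j + Suc i \<in> {?n - j<..<?n}" using assms by auto
      then have "?n - j + Suc i \<in> ASC p" using * by blast
      then show "p ! (?n - j + i) < p ! (?n - j + Suc i)"
        using i assms by (auto simp: ASC_def letter_def)
    qed
  qed
  finally show ?thesis .
qed

text \<open>A decreasing prefix of length \<open>j\<close> means descents at \<open>1, \<dots>, j - 1\<close>; reversed, these are the ascents
  of an increasing suffix of length \<open>j\<close>.\<close>

lemma ldr_eq_rar:
  assumes D: "DES p = ASC_rev q" and n: "length p = length q"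
  shows "ldr p = rar q"
proof -
  let ?n = "length q"
  have mem: "i \<in> DES p \<longleftrightarrow> ?n - i \<in> ASC q" if "1 \<le> i" "i < ?n" for i
  proof -
    have "?n - i = k" if "i = ?n - k" "k \<in> ASC q" for k using that by (auto simp: ASC_def)
    moreover have "?n - (?n - i) = i" using that by simp
    ultimately show ?thesis unfolding D ASC_rev_image by (metis (no_types, lifting) image_iff)
  qed
  have "{1..<j} \<subseteq> DES p \<longleftrightarrow> {?n - j<..<?n} \<subseteq> ASC q" if "j \<le> ?n" for j
  proof
    assume *: "{1..<j} \<subseteq> DES p"
    show "{?n - j<..<?n} \<subseteq> ASC q"
    proof
      fix i assume "i \<in> {?n - j<..<?n}"
      then have "?n - i \<in> {1..<j}" "?n - (?n - i) = i" "1 \<le> ?n - i" "?n - i < ?n" using that by auto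
      then show "i \<in> ASC q" using * mem[of "?n - i"] by auto
    qed
  next
    assume *: "{?n - j<..<?n} \<subseteq> ASC q"
    show "{1..<j} \<subseteq> DES p"
    proof
      fix i assume "i \<in> {1..<j}"
      then have "?n - i \<in> {?n - j<..<?n}" "1 \<le> i" "i < ?n" using that by auto
      then show "i \<in> DES p" using * mem[of i] by auto
    qed
  qed
  then have "{j \<in> {1..length p}. sorted_wrt (>) (take j p)} =
      {j \<in> {1..length q}. sorted_wrt (<) (drop (length q - j) q)}"
    using decreasing_take_iff[of _ p] increasing_drop_iff[of _ q] n by auto
  then show ?thesis by (simp add: ldr_def rar_def)
qed

section \<open>The involution\<close>

definition mirror_perm :: "nat list \<Rightarrow> nat list" where
  "mirror_perm p = word 0 (mirror (inv (word 0) p))"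

lemma mirror_perm_word: "mirror_perm (word 0 t) = word 0 (mirror t)"
proof -
  have "inj (word 0)" by (auto intro: injI word_inj)
  then show ?thesis by (simp add: mirror_perm_def)
qed

theorem theorem3p6:
  fixes n :: nat
  assumes "n \<ge> 1"
  shows "(\<exists>\<Lambda> :: nat list \<Rightarrow> nat list.
            involution_on (Av_312 n) \<Lambda> \<and>
            (n \<ge> 2 \<longrightarrow> (\<forall>p \<in> Av_312 n.
               (DES p, pk1 p, lmin p) = (ASC_rev (\<Lambda> p), pk2 (\<Lambda> p), rmin (\<Lambda> p)))) \<and>
            (\<forall>p \<in> Av_312 n.
               (mnd p, mna p, des p, asc p, ldr p, rar p, lmin p, rmin p) =
               (mna (\<Lambda> p), mnd (\<Lambda> p), asc (\<Lambda> p), des (\<Lambda> p),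
                rar (\<Lambda> p), ldr (\<Lambda> p), rmin (\<Lambda> p), lmin (\<Lambda> p)))) \<and>
         equidistributed_on (Av_312 n)
           (\<lambda>p. (mnd p, mna p, des p, asc p, ldr p, rar p, lmin p, rmin p))
           (\<lambda>p. (mna p, mnd p, asc p, des p, rar p, ldr p, rmin p, lmin p))"
proof -
  let ?A = "Av_312 n" and ?M = mirror_perm
  let ?F = "\<lambda>p. (mnd p, mna p, des p, asc p, ldr p, rar p, lmin p, rmin p)"
  let ?G = "\<lambda>p. (mna p, mnd p, asc p, des p, rar p, ldr p, rmin p, lmin p)"
  have tree: "\<exists>t. size t = n \<and> p = word 0 t" if "p \<in> ?A" for p
    using bij_betw_word[of n] that unfolding bij_betw_def by blast
  have closed: "?M p \<in> ?A" and invol: "?M (?M p) = p" and reflects: "reflected p (?M p)"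
    and len: "length p = n" if p: "p \<in> ?A" for p
  proof -
    obtain t where t: "size t = n" "p = word 0 t" using tree[OF p] by blast
    have "word 0 (mirror t) \<in> ?A"
      using bij_betw_word[of n] t(1) unfolding bij_betw_def by auto
    then show "?M p \<in> ?A" by (simp add: t(2) mirror_perm_word)
    show "?M (?M p) = p" by (simp add: t(2) mirror_perm_word)
    show "reflected p (?M p)" by (simp add: t(2) mirror_perm_word reflected_word_mirror)
    show "length p = n" using t by simp
  qed
  have triple: "(DES p, pk1 p, lmin p) = (ASC_rev (?M p), pk2 (?M p), rmin (?M p))"
    if "n \<ge> 2" "p \<in> ?A" for p
    using reflected_DES[OF reflects] reflected_pk[OF reflects] reflected_lmin[OF reflects] that len by auto
  \<comment> \<open>The other four coordinates arise from these by applying them to the image of \<open>p\<close>.\<close>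
  have half: "mnd p = mna (?M p)" "des p = asc (?M p)" "ldr p = rar (?M p)" "lmin p = rmin (?M p)"
    if p: "p \<in> ?A" for p
    using mnd_eq_mna[OF reflected_DES[OF reflects[OF p]]] des_eq_asc[OF reflected_DES[OF reflects[OF p]]]
      ldr_eq_rar[OF reflected_DES[OF reflects[OF p]]] reflected_lmin[OF reflects[OF p]]
      len[OF p] len[OF closed[OF p]] by auto
  have eight: "?F p = ?G (?M p)" if p: "p \<in> ?A" for p
    using half[OF p] half[OF closed[OF p]] invol[OF p] by simp
  have "equidistributed_on ?A ?F ?G" unfolding equidistributed_on_def
  proof
    fix v
    have "bij_betw ?M {p \<in> ?A. ?F p = v} {p \<in> ?A. ?G p = v}"
    proof (rule bij_betwI[where g = ?M])
      have "?F (?M p) = ?G p" if "p \<in> ?A" for p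
        using eight[OF closed[OF that]] invol[OF that] by simp
      then show "?M \<in> {p \<in> ?A. ?G p = v} \<rightarrow> {p \<in> ?A. ?F p = v}" using closed by auto
      show "?M \<in> {p \<in> ?A. ?F p = v} \<rightarrow> {p \<in> ?A. ?G p = v}" using closed eight by auto
    qed (use invol in auto)
    then show "card {p \<in> ?A. ?F p = v} = card {p \<in> ?A. ?G p = v}" by (rule bij_betw_same_card)
  qed
  moreover have "involution_on ?A ?M" using closed invol by (simp add: involution_on_def)
  ultimately show ?thesis using triple eight by blast
qed

end
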